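(* Let $X$ be an infinite set. For every discrete space $Y$ with $|Y| \leq |X|$, the space $Top(X)$ contains a subspace homeomorphic to the Stone–Čech compactification $\beta Y$.
   Context: $2^{\mathcal{P}(X)}$ is the set $\mathcal{P}(\mathcal{P}(X))$ of all families of subsets of $X$ with the product topology ($2=\{0,1\}$ discrete). $Top(X) \subseteq 2^{\mathcal{P}(X)}$ is the set of all topologies on $X$, with the subspace topology. *)

theory Defs
  imports "HOL-Analysis.Analysis"
begin

(* The families of subsets of X with the product topology of 2 = {0,1} over Pow X; a family F is
   identified with its characteristic function on Pow X, and bool plays the role of 2. *)
definition families_space :: "'a set \<Rightarrow> 'a set set topology" where
  "families_space X =
     pullback_topology (Pow (Pow X)) (\<lambda>F. \<lambda>A\<in>Pow X. A \<in> F)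
       (product_topology (\<lambda>_. discrete_topology (UNIV :: bool set)) (Pow X))"

definition topologies_on :: "'a set \<Rightarrow> 'a set set set" where
  "topologies_on X = {Collect (openin T) | T. topspace T = X}"

definition Top_space :: "'a set \<Rightarrow> 'a set set topology" where
  "Top_space X = subtopology (families_space X) (topologies_on X)"

(* Functions are taken extensional, so that each continuous map on Y occurs only once. *)
definition unit_interval_maps :: "'b topology \<Rightarrow> ('b \<Rightarrow> real) set" where
  "unit_interval_maps Y =
     {f \<in> extensional (topspace Y). continuous_map Y (top_of_set {0..1}) f}"

(* The closure of the image of Y under the evaluation map into the cube
   [0,1]^C(Y,[0,1]); for completely regular Hausdorff Y (in particular discrete Y)
   this is the Stone-Cech compactification. *)
definition Stone_Cech :: "'b topology \<Rightarrow> (('b \<Rightarrow> real) \<Rightarrow> real) topology" where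
  "Stone_Cech Y =
     (let cube = product_topology (\<lambda>_. top_of_set {0..1}) (unit_interval_maps Y)
      in subtopology cube
           (cube closure_of ((\<lambda>y. \<lambda>f\<in>unit_interval_maps Y. f y) ` topspace Y)))"

end

theory Submission
  imports Defs
begin

text \<open>
  Points of \<open>\<beta>Y\<close> for a discrete \<open>Y\<close> are ultrafilters on \<open>Y\<close>, and a filter is almost a topology: it
  is closed under finite intersections and nonempty unions, and lacks only the empty set.  Embed \<open>Y\<close> into \<open>X\<close> by
  an injection \<open>e\<close> that misses a point \<open>p\<close>; this is possible because \<open>X\<close> is infinite.  A filter \<open>U\<close> on
  \<open>Y\<close> then yields the topology on \<open>X\<close> in which every point other than \<open>p\<close> is isolated, and a set
  containing \<open>p\<close> is open iff its preimage under \<open>e\<close> belongs to \<open>U\<close>.  Membership of a fixed set in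
  this topology depends only on membership of one set in \<open>U\<close>, which is a clopen condition on
  \<open>\<beta>Y\<close>; so the assignment is continuous.  It is injective since \<open>U\<close> can be read off from the open
  sets \<open>e ` B \<union> {p}\<close>.  As \<open>\<beta>Y\<close> is compact and \<open>Top_space X\<close> is Hausdorff, it is an embedding.

  In the cube, the ultrafilter of a point \<open>z\<close> consists of the sets whose characteristic function has
  \<open>z\<close>-coordinate \<open>1\<close>.  That these sets form a filter (\<open>ultrafilter_at_Int\<close>, \<open>ultrafilter_at_mono\<close>) and that they
  determine \<open>z\<close> (\<open>ultrafilter_at_determines_point\<close>) both come from \<open>Stone_Cech_identity\<close>: an identity between
  continuous real functions on the cube holds on all of \<open>\<beta>Y\<close> once it holds at the points of \<open>Y\<close>,
  because these are dense.
\<close>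

section \<open>The spaces \<open>\<beta>Y\<close> and \<open>Top(X)\<close>\<close>

definition cube :: "'b topology \<Rightarrow> (('b \<Rightarrow> real) \<Rightarrow> real) topology" where
  "cube Y = product_topology (\<lambda>_. top_of_set {0..1}) (unit_interval_maps Y)"

definition point_evaluation :: "'b topology \<Rightarrow> 'b \<Rightarrow> ('b \<Rightarrow> real) \<Rightarrow> real" where
  "point_evaluation Y y = (\<lambda>f\<in>unit_interval_maps Y. f y)"

lemma Stone_Cech_eq:
  "Stone_Cech Y = subtopology (cube Y) (cube Y closure_of (point_evaluation Y ` topspace Y))"
  by (simp add: Stone_Cech_def cube_def point_evaluation_def[abs_def] Let_def)

lemma topspace_Stone_Cech:
  "topspace (Stone_Cech Y) = cube Y closure_of (point_evaluation Y ` topspace Y)"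
  unfolding Stone_Cech_eq by (simp add: closure_of_subset_topspace inf.absorb2)

lemma compact_space_Stone_Cech: "compact_space (Stone_Cech Y)"
proof -
  have "compact_space (cube Y)"
    unfolding cube_def compact_space_product_topology
    by (simp add: compact_space_subtopology)
  then show ?thesis
    unfolding Stone_Cech_eq
    by (intro compact_space_subtopology closedin_compact_space closedin_closure_of)
qed

lemma continuous_map_cube_coordinate:
  assumes "f \<in> unit_interval_maps Y"
  shows "continuous_map (cube Y) euclideanreal (\<lambda>z. z f)"
  using continuous_map_product_projection[OF assms, of "\<lambda>_. top_of_set {0..1}"]
  unfolding cube_def continuous_map_in_subtopology by (rule conjunct1)

lemma Stone_Cech_identity:
  assumes "z \<in> topspace (Stone_Cech Y)"
    and "continuous_map (cube Y) euclideanreal g"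
    and "\<And>y. y \<in> topspace Y \<Longrightarrow> g (point_evaluation Y y) = 0"
  shows "g z = (0::real)"
proof (rule forall_in_closure_of_eq[where x = z and f = g and g = "\<lambda>_. 0"])
  show "z \<in> cube Y closure_of (point_evaluation Y ` topspace Y)"
    using assms(1) by (simp add: topspace_Stone_Cech)
qed (use assms in auto)

lemma Hausdorff_space_families: "Hausdorff_space (families_space X)"
proof (rule Hausdorff_space_injective_preimage)
  let ?P = "product_topology (\<lambda>_. discrete_topology (UNIV :: bool set)) (Pow X)"
  let ?\<chi> = "\<lambda>F. \<lambda>A\<in>Pow X. A \<in> F"
  show "Hausdorff_space ?P"
    by (simp add: Hausdorff_space_product_topology)
  show "continuous_map (families_space X) ?P ?\<chi>"
    using continuous_map_pullback[OF continuous_map_id, of "Pow (Pow X)" ?\<chi> ?P]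
    by (simp add: families_space_def)
  show "inj_on ?\<chi> (topspace (families_space X))"
  proof (rule inj_onI)
    fix F G :: "'a set set"
    assume F: "F \<in> topspace (families_space X)" and G: "G \<in> topspace (families_space X)"
      and eq: "?\<chi> F = ?\<chi> G"
    have "F \<subseteq> Pow X" "G \<subseteq> Pow X"
      using F G by (auto simp: families_space_def topspace_pullback_topology)
    moreover have "A \<in> F \<longleftrightarrow> A \<in> G" if "A \<in> Pow X" for A
      using fun_cong[OF eq, of A] that by simp
    ultimately show "F = G"
      by (intro set_eqI) (meson subsetD)
  qed
qed

lemma Hausdorff_space_Top_space: "Hausdorff_space (Top_space X)"
  unfolding Top_space_def by (intro Hausdorff_space_subtopology Hausdorff_space_families)

lemma continuous_map_into_Top_spaceI:
  assumes topologies: "\<And>z. z \<in> topspace Z \<Longrightarrow> \<Phi> z \<in> topologies_on X"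
    and membership: "\<And>A. A \<subseteq> X \<Longrightarrow> continuous_map Z (discrete_topology UNIV) (\<lambda>z. A \<in> \<Phi> z)"
  shows "continuous_map Z (Top_space X) \<Phi>"
  unfolding Top_space_def families_space_def continuous_map_in_subtopology
proof (intro conjI continuous_map_pullback')
  show "\<Phi> \<in> topspace Z \<rightarrow> topologies_on X"
    using topologies by blast
  show "topspace Z \<subseteq> \<Phi> -` Pow (Pow X)"
  proof (clarsimp)
    fix z A x
    assume "z \<in> topspace Z" "A \<in> \<Phi> z" "x \<in> A"
    then show "x \<in> X"
      using topologies[of z] openin_subset by (fastforce simp: topologies_on_def)
  qed
  show "continuous_map Z (product_topology (\<lambda>_. discrete_topology UNIV) (Pow X))
          ((\<lambda>F. \<lambda>A\<in>Pow X. A \<in> F) \<circ> \<Phi>)"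
    unfolding continuous_map_componentwise using membership by auto
qed

section \<open>The ultrafilter of a point of \<open>\<beta>Y\<close>\<close>

definition char_map :: "'b set \<Rightarrow> 'b set \<Rightarrow> 'b \<Rightarrow> real" where
  "char_map Y B = (\<lambda>y\<in>Y. indicator B y)"

definition ultrafilter_at :: "'b set \<Rightarrow> (('b \<Rightarrow> real) \<Rightarrow> real) \<Rightarrow> 'b set set" where
  "ultrafilter_at Y z = {B. B \<subseteq> Y \<and> z (char_map Y B) = 1}"

lemma char_map_in_maps: "char_map Y B \<in> unit_interval_maps (discrete_topology Y)"
  by (auto simp: unit_interval_maps_def char_map_def indicator_def)

lemma point_evaluation_char_map:
  "y \<in> Y \<Longrightarrow> point_evaluation (discrete_topology Y) y (char_map Y B) = indicator B y"
  using char_map_in_maps[of Y B] by (simp add: point_evaluation_def char_map_def)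

context
  fixes Y :: "'b set" and z :: "('b \<Rightarrow> real) \<Rightarrow> real"
  assumes z: "z \<in> topspace (Stone_Cech (discrete_topology Y))"
begin

lemmas coordinate_continuous =
  continuous_map_cube_coordinate[of _ "discrete_topology Y"]

lemma char_coordinate_cases: "z (char_map Y B) = 0 \<or> z (char_map Y B) = 1"
proof -
  have "z (char_map Y B) * (z (char_map Y B) - 1) = 0"
    by (rule Stone_Cech_identity[OF z])
       (auto intro!: continuous_intros coordinate_continuous char_map_in_maps
             simp: point_evaluation_char_map indicator_def)
  then show ?thesis
    by auto
qed

lemma char_coordinate_Int:
  "z (char_map Y (B \<inter> C)) = z (char_map Y B) * z (char_map Y C)"
proof -
  have "z (char_map Y (B \<inter> C)) - z (char_map Y B) * z (char_map Y C) = 0"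
    by (rule Stone_Cech_identity[OF z])
       (auto intro!: continuous_intros coordinate_continuous char_map_in_maps
             simp: point_evaluation_char_map indicator_def)
  then show ?thesis
    by simp
qed

lemma ultrafilter_at_whole: "Y \<in> ultrafilter_at Y z"
proof -
  have "z (char_map Y Y) - 1 = 0"
    by (rule Stone_Cech_identity[OF z])
       (auto intro!: continuous_intros coordinate_continuous char_map_in_maps
             simp: point_evaluation_char_map indicator_def)
  then show ?thesis
    by (simp add: ultrafilter_at_def)
qed

lemma ultrafilter_at_Int:
  "B \<in> ultrafilter_at Y z \<Longrightarrow> C \<in> ultrafilter_at Y z \<Longrightarrow> B \<inter> C \<in> ultrafilter_at Y z"
  by (auto simp: ultrafilter_at_def char_coordinate_Int)

lemma ultrafilter_at_mono:
  "B \<in> ultrafilter_at Y z \<Longrightarrow> B \<subseteq> C \<Longrightarrow> C \<subseteq> Y \<Longrightarrow> C \<in> ultrafilter_at Y z"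
  using char_coordinate_Int[of B C] by (auto simp: ultrafilter_at_def inf.absorb1)

text \<open>The set where \<open>f\<close> is below a level \<open>c\<close> decides on which side of \<open>c\<close> the coordinate \<open>z f\<close> lies:
  each of the two products below vanishes at every point of \<open>Y\<close>.\<close>

lemma
  assumes f: "f \<in> unit_interval_maps (discrete_topology Y)"
  shows sublevel_in_ultrafilter_at: "z f < c \<Longrightarrow> {y \<in> Y. f y < c} \<in> ultrafilter_at Y z"
    and sublevel_notin_ultrafilter_at: "c < z f \<Longrightarrow> {y \<in> Y. f y < c} \<notin> ultrafilter_at Y z"
proof -
  let ?B = "{y \<in> Y. f y < c}"
  have "(1 - z (char_map Y ?B)) * max 0 (c - z f) = 0"
    by (rule Stone_Cech_identity[OF z])
       (use f in \<open>auto intro!: continuous_intros coordinate_continuous char_map_in_maps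
             simp: point_evaluation_char_map indicator_def, auto simp: point_evaluation_def\<close>)
  then show "z f < c \<Longrightarrow> ?B \<in> ultrafilter_at Y z"
    by (auto simp: ultrafilter_at_def)
  have "z (char_map Y ?B) * max 0 (z f - c) = 0"
    by (rule Stone_Cech_identity[OF z])
       (use f in \<open>auto intro!: continuous_intros coordinate_continuous char_map_in_maps
             simp: point_evaluation_char_map indicator_def, auto simp: point_evaluation_def\<close>)
  then show "c < z f \<Longrightarrow> ?B \<notin> ultrafilter_at Y z"
    by (auto simp: ultrafilter_at_def)
qed

end

text \<open>If two points differ in the coordinate \<open>f\<close>, a level strictly between the two values
  gives a sublevel set of \<open>f\<close> that lies in exactly one of the two ultrafilters.\<close>

lemma ultrafilter_at_determines_point:
  assumes z: "z \<in> topspace (Stone_Cech (discrete_topology Y))"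
    and w: "w \<in> topspace (Stone_Cech (discrete_topology Y))"
    and eq: "ultrafilter_at Y z = ultrafilter_at Y w"
  shows "z = w"
proof (rule extensionalityI)
  let ?M = "unit_interval_maps (discrete_topology Y)"
  have "topspace (Stone_Cech (discrete_topology Y)) \<subseteq> extensional ?M"
    by (auto simp: Stone_Cech_eq cube_def PiE_def)
  then show "z \<in> extensional ?M" "w \<in> extensional ?M"
    using z w by auto
  fix f assume f: "f \<in> ?M"
  have "\<not> u f < v f"
    if "u \<in> topspace (Stone_Cech (discrete_topology Y))"
      "v \<in> topspace (Stone_Cech (discrete_topology Y))" "ultrafilter_at Y u = ultrafilter_at Y v" for u v
  proof
    assume "u f < v f"
    then obtain c where "u f < c" "c < v f"
      using dense by blast
    then show False
      using sublevel_in_ultrafilter_at[OF that(1) f] sublevel_notin_ultrafilter_at[OF that(2) f] that(3) by blast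
  qed
  from this[OF z w eq] this[OF w z eq[symmetric]] show "z f = w f"
    by linarith
qed

section \<open>The topology of a filter\<close>

definition filter_topology ::
    "'a set \<Rightarrow> 'a \<Rightarrow> 'b set \<Rightarrow> ('b \<Rightarrow> 'a) \<Rightarrow> 'b set set \<Rightarrow> 'a set set" where
  "filter_topology X p Y e U = {A. A \<subseteq> X \<and> (p \<in> A \<longrightarrow> {y \<in> Y. e y \<in> A} \<in> U)}"

lemma filter_topology_in_topologies_on:
  assumes whole: "Y \<in> U"
    and Int: "\<And>B C. B \<in> U \<Longrightarrow> C \<in> U \<Longrightarrow> B \<inter> C \<in> U"
    and mono: "\<And>B C. B \<in> U \<Longrightarrow> B \<subseteq> C \<Longrightarrow> C \<subseteq> Y \<Longrightarrow> C \<in> U"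
    and e: "e ` Y \<subseteq> X"
  shows "filter_topology X p Y e U \<in> topologies_on X"
proof -
  let ?T = "filter_topology X p Y e U"
  have "istopology (\<lambda>A. A \<in> ?T)"
    unfolding istopology_def
  proof (intro conjI allI impI)
    fix A B assume "A \<in> ?T" "B \<in> ?T"
    moreover have "{y \<in> Y. e y \<in> A \<inter> B} = {y \<in> Y. e y \<in> A} \<inter> {y \<in> Y. e y \<in> B}"
      by auto
    ultimately show "A \<inter> B \<in> ?T"
      using Int by (auto simp: filter_topology_def)
  next
    fix K assume K: "\<forall>A\<in>K. A \<in> ?T"
    have "{y \<in> Y. e y \<in> \<Union>K} \<in> U" if pK: "p \<in> \<Union>K"
    proof -
      obtain A where A: "A \<in> K" "p \<in> A"
        using pK by blast
      then have "{y \<in> Y. e y \<in> A} \<in> U"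
        using K by (auto simp: filter_topology_def)
      then show ?thesis
        by (rule mono) (use A in auto)
    qed
    then show "\<Union>K \<in> ?T"
      using K by (auto simp: filter_topology_def)
  qed
  then have opens: "openin (topology (\<lambda>A. A \<in> ?T)) = (\<lambda>A. A \<in> ?T)"
    by (rule topology_inverse')
  have "{y \<in> Y. e y \<in> X} = Y"
    using e by auto
  then have "X \<in> ?T"
    using whole by (simp add: filter_topology_def)
  then have "topspace (topology (\<lambda>A. A \<in> ?T)) = X"
    unfolding topspace_def opens by (auto simp: filter_topology_def)
  then show ?thesis
    unfolding topologies_on_def using opens by force
qed

lemma filter_topology_inj:
  assumes e: "inj_on e Y" "e ` Y \<subseteq> X" and p: "p \<in> X" "p \<notin> e ` Y"
    and U: "U \<subseteq> Pow Y" and V: "V \<subseteq> Pow Y"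
    and eq: "filter_topology X p Y e U = filter_topology X p Y e V"
  shows "U = V"
proof -
  have "insert p (e ` B) \<in> filter_topology X p Y e W \<longleftrightarrow> B \<in> W" if "B \<subseteq> Y" for B W
  proof -
    have "{y \<in> Y. e y \<in> insert p (e ` B)} = B"
      using that e p by (auto simp: inj_on_def)
    moreover have "insert p (e ` B) \<subseteq> X"
      using that e p by auto
    ultimately show ?thesis
      by (simp add: filter_topology_def)
  qed
  from this[of _ U] this[of _ V] have "B \<in> U \<longleftrightarrow> B \<in> V" if "B \<subseteq> Y" for B
    unfolding eq using that by simp
  then show ?thesis
    using U V by blast
qed

section \<open>The embedding\<close>

text \<open>A coordinate at a characteristic function takes only the values \<open>0\<close> and \<open>1\<close> on \<open>\<beta>Y\<close>, so it is
  continuous into a discrete space.  The guard \<open>P\<close> stands for the condition that the set whose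
  openness is tested contains \<open>p\<close>.\<close>

lemma continuous_map_ultrafilter_at_membership:
  "continuous_map (Stone_Cech (discrete_topology Y)) (discrete_topology UNIV)
     (\<lambda>z. P \<longrightarrow> B \<in> ultrafilter_at Y z)"
proof -
  let ?S = "Stone_Cech (discrete_topology Y)"
  have "continuous_map ?S euclideanreal (\<lambda>z. z (char_map Y B))"
    unfolding Stone_Cech_eq
    by (intro continuous_map_from_subtopology continuous_map_cube_coordinate char_map_in_maps)
  then have "continuous_map ?S (top_of_set {0, 1::real}) (\<lambda>z. z (char_map Y B))"
    using char_coordinate_cases by (auto simp: continuous_map_in_subtopology)
  moreover have "top_of_set {0, 1::real} = discrete_topology {0, 1}"
    by (intro subtopology_eq_discrete_topology_finite) (auto intro: Hausdorff_imp_t1_space)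
  moreover have "continuous_map (discrete_topology {0, 1::real}) (discrete_topology UNIV)
      (\<lambda>r. P \<longrightarrow> B \<subseteq> Y \<and> r = 1)"
    by simp
  ultimately have "continuous_map ?S (discrete_topology UNIV)
      ((\<lambda>r. P \<longrightarrow> B \<subseteq> Y \<and> r = 1) \<circ> (\<lambda>z. z (char_map Y B)))"
    by (metis continuous_map_compose)
  then show ?thesis
    by (simp add: ultrafilter_at_def o_def)
qed

lemma lepoll_infinite_missing_point:
  assumes "infinite X" "Y \<lesssim> X"
  obtains e p where "inj_on e Y" "e ` Y \<subseteq> X" "p \<in> X" "p \<notin> e ` Y"
proof -
  obtain Z where "Z \<subset> X" "X \<lesssim> Z"
    using \<open>infinite X\<close> unfolding infinite_iff_psubset_le by blast
  then obtain e where "inj_on e Y" "e ` Y \<subseteq> Z"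
    using lepoll_trans[OF \<open>Y \<lesssim> X\<close>] unfolding lepoll_def by metis
  then show thesis
    using that \<open>Z \<subset> X\<close> by blast
qed

theorem theorem6p5:
  fixes X :: "'a set" and Y :: "'b set"
  assumes "infinite X" and "Y \<lesssim> X"
  shows "\<exists>S \<subseteq> topspace (Top_space X).
           subtopology (Top_space X) S homeomorphic_space Stone_Cech (discrete_topology Y)"
proof -
  obtain e p where e: "inj_on e Y" "e ` Y \<subseteq> X" and p: "p \<in> X" "p \<notin> e ` Y"
    using lepoll_infinite_missing_point[OF assms] by blast
  let ?S = "Stone_Cech (discrete_topology Y)"
  let ?\<Phi> = "\<lambda>z. filter_topology X p Y e (ultrafilter_at Y z)"
  have cont: "continuous_map ?S (Top_space X) ?\<Phi>"
  proof (rule continuous_map_into_Top_spaceI)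
    show "?\<Phi> z \<in> topologies_on X" if "z \<in> topspace ?S" for z
    proof (rule filter_topology_in_topologies_on)
      show "Y \<in> ultrafilter_at Y z"
        by (rule ultrafilter_at_whole[OF that])
      show "B \<inter> C \<in> ultrafilter_at Y z" if "B \<in> ultrafilter_at Y z" "C \<in> ultrafilter_at Y z" for B C
        using \<open>z \<in> topspace ?S\<close> that by (rule ultrafilter_at_Int)
      show "C \<in> ultrafilter_at Y z" if "B \<in> ultrafilter_at Y z" "B \<subseteq> C" "C \<subseteq> Y" for B C
        using \<open>z \<in> topspace ?S\<close> that by (rule ultrafilter_at_mono)
    qed (rule e(2))
    show "continuous_map ?S (discrete_topology UNIV) (\<lambda>z. A \<in> ?\<Phi> z)" if "A \<subseteq> X" for A
      using continuous_map_ultrafilter_at_membership[of Y "p \<in> A" "{y \<in> Y. e y \<in> A}"] that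
      by (simp add: filter_topology_def)
  qed
  have "inj_on ?\<Phi> (topspace ?S)"
  proof (rule inj_onI)
    fix z w assume "z \<in> topspace ?S" "w \<in> topspace ?S" and eq: "?\<Phi> z = ?\<Phi> w"
    moreover have "ultrafilter_at Y z = ultrafilter_at Y w"
      by (rule filter_topology_inj[OF e p _ _ eq]) (auto simp: ultrafilter_at_def)
    ultimately show "z = w"
      by (blast intro: ultrafilter_at_determines_point)
  qed
  then have "embedding_map ?S (Top_space X) ?\<Phi>"
    by (intro continuous_imp_embedding_map cont compact_space_Stone_Cech Hausdorff_space_Top_space)
  then have "?S homeomorphic_space subtopology (Top_space X) (?\<Phi> ` topspace ?S)"
    by (rule embedding_map_imp_homeomorphic_space)
  moreover have "?\<Phi> ` topspace ?S \<subseteq> topspace (Top_space X)"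
    using cont by (rule continuous_map_image_subset_topspace)
  ultimately show ?thesis
    using homeomorphic_space_sym by blast
qed

end
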